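(* Let $n\ge 2$, let $(X,\|\cdot\|)$ be a normed linear space over $\mathbb{K}$ ($\mathbb{K}=\mathbb{R}$ or $\mathbb{C}$), $\mathbf{a}=(a_1,\dots,a_n)\in\mathbb{K}^n$, $\mathbf{p}=(p_1,\dots,p_n)\in\mathbb{R}^n$ and $\mathbf{x}=(x_1,\dots,x_n)\in X^n$. Assume $P_i\neq0$ for $i=1,\dots,n$, and put $$E_i:=\frac{A_n(\mathbf{p})}{P_n}-\frac{A_i(\mathbf{p})}{P_i},\qquad i\in\{1,\dots,n-1\}.$$ Then the following three inequalities hold: (i) $\displaystyle \|T_n(\mathbf{p};\mathbf{a},\mathbf{x})\|\le |P_n|\max_{1\le i\le n-1}|E_i|\cdot\sum_{i=1}^{n-1}|P_i|\,\|\Delta x_i\|$; (ii) for all real $p>1$ and $q$ with $\frac1p+\frac1q=1$, $\displaystyle \|T_n(\mathbf{p};\mathbf{a},\mathbf{x})\|\le |P_n|\Big(\sum_{i=1}^{n-1}|P_i|\,|E_i|^q\Big)^{1/q}\Big(\sum_{i=1}^{n-1}|P_i|\,\|\Delta x_i\|^p\Big)^{1/p}$; (iii) $\displaystyle \|T_n(\mathbf{p};\mathbf{a},\mathbf{x})\|\le |P_n|\sum_{i=1}^{n-1}|P_i|\,|E_i|\cdot\max_{1\le i\le n-1}\|\Delta x_i\|$. Moreover, each of these inequalities is sharp in the sense that the constant $1$ multiplying its right-hand side cannot be replaced by a smaller constant.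
   Context: The Čebyšev functional is $T_n(\mathbf{p};\mathbf{a},\mathbf{x}):=P_n\sum_{i=1}^n p_ia_ix_i-\left(\sum_{i=1}^n p_ia_i\right)\cdot\sum_{i=1}^n p_ix_i$. Notation: $P_i:=\sum_{k=1}^i p_k$ and $A_i(\mathbf{p}):=\sum_{k=1}^i p_ka_k$ for $1\le i\le n$; $\Delta x_i:=x_{i+1}-x_i$ for $1\le i\le n-1$. The bold $\mathbf{p}$ is the weight tuple; the exponent $p$ is unrelated to it. Sharpness of an inequality $\|T_n\|\le R$ (with $p,q$ fixed, in the case of (ii)) means: if $C>0$ is a constant such that $\|T_n\|\le C\,R$ for all $n\ge2$, all normed spaces $X$ and all admissible $\mathbf{p},\mathbf{a},\mathbf{x}$, then $C\ge1$. *)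

theory Defs
  imports Complex_Main
begin

(* A normed linear space over the scalar field 'k. Every real_normed_field is isometrically
   isomorphic to the reals or the complex numbers (Gelfand-Mazur), so 'k ranges over exactly
   these two cases. The underlying norm is that of real_normed_vector, which loses nothing:
   a complex normed space is a real one by restriction of scalars. Conversely,
   scale (of_real r) x = r *\<^sub>R x need not be assumed: homogeneity of the norm makes both sides
   continuous and additive in r, and they agree at r = 1. *)
locale normed_space_over =
  vector_space scale
  for scale :: "'k::real_normed_field \<Rightarrow> 'x::real_normed_vector \<Rightarrow> 'x" +
  assumes norm_scale: "norm (scale c x) = norm c * norm x"

lemma normed_space_over_scaleR:
  "normed_space_over (scaleR :: real \<Rightarrow> 'x::real_normed_vector \<Rightarrow> 'x)"
  by unfold_locales (auto simp: algebra_simps)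

lemma normed_space_over_self:
  "normed_space_over ((*) :: 'k::real_normed_field \<Rightarrow> 'k \<Rightarrow> 'k)"
  by unfold_locales (auto simp: algebra_simps norm_mult)

(* n-tuples are functions on nat of which only the values at 1..n are used. *)

definition P :: "(nat \<Rightarrow> real) \<Rightarrow> nat \<Rightarrow> real" where
  "P p i = (\<Sum>k=1..i. p k)"

definition A :: "(nat \<Rightarrow> real) \<Rightarrow> (nat \<Rightarrow> 'k::real_normed_field) \<Rightarrow> nat \<Rightarrow> 'k" where
  "A p a i = (\<Sum>k=1..i. of_real (p k) * a k)"

definition E :: "nat \<Rightarrow> (nat \<Rightarrow> real) \<Rightarrow> (nat \<Rightarrow> 'k::real_normed_field) \<Rightarrow> nat \<Rightarrow> 'k" where
  "E n p a i = A p a n / of_real (P p n) - A p a i / of_real (P p i)"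

definition \<Delta> :: "(nat \<Rightarrow> 'x::real_normed_vector) \<Rightarrow> nat \<Rightarrow> 'x" where
  "\<Delta> x i = x (i + 1) - x i"

definition cebysev ::
  "('k::real_normed_field \<Rightarrow> 'x::real_normed_vector \<Rightarrow> 'x) \<Rightarrow>
   nat \<Rightarrow> (nat \<Rightarrow> real) \<Rightarrow> (nat \<Rightarrow> 'k) \<Rightarrow> (nat \<Rightarrow> 'x) \<Rightarrow> 'x" where
  "cebysev scale n p a x =
     scale (of_real (P p n)) (\<Sum>i=1..n. scale (of_real (p i) * a i) (x i))
     - scale (\<Sum>i=1..n. of_real (p i) * a i) (\<Sum>i=1..n. scale (of_real (p i)) (x i))"

definition bound_max_sum ::
  "nat \<Rightarrow> (nat \<Rightarrow> real) \<Rightarrow> (nat \<Rightarrow> 'k::real_normed_field) \<Rightarrow> (nat \<Rightarrow> 'x::real_normed_vector) \<Rightarrow> real" where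
  "bound_max_sum n p a x =
     \<bar>P p n\<bar> * Max ((\<lambda>i. norm (E n p a i)) ` {1..n-1})
       * (\<Sum>i=1..n-1. \<bar>P p i\<bar> * norm (\<Delta> x i))"

definition bound_Hoelder ::
  "real \<Rightarrow> real \<Rightarrow>
   nat \<Rightarrow> (nat \<Rightarrow> real) \<Rightarrow> (nat \<Rightarrow> 'k::real_normed_field) \<Rightarrow> (nat \<Rightarrow> 'x::real_normed_vector) \<Rightarrow> real" where
  "bound_Hoelder r s n p a x =
     \<bar>P p n\<bar> * (\<Sum>i=1..n-1. \<bar>P p i\<bar> * norm (E n p a i) powr s) powr (1 / s)
       * (\<Sum>i=1..n-1. \<bar>P p i\<bar> * norm (\<Delta> x i) powr r) powr (1 / r)"

definition bound_sum_max ::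
  "nat \<Rightarrow> (nat \<Rightarrow> real) \<Rightarrow> (nat \<Rightarrow> 'k::real_normed_field) \<Rightarrow> (nat \<Rightarrow> 'x::real_normed_vector) \<Rightarrow> real" where
  "bound_sum_max n p a x =
     \<bar>P p n\<bar> * (\<Sum>i=1..n-1. \<bar>P p i\<bar> * norm (E n p a i))
       * Max ((\<lambda>i. norm (\<Delta> x i)) ` {1..n-1})"

(* The scalars 'k and the space 'x are types and cannot be quantified over inside the hypothesis
   on C, so sharpness is expressed within one given space. If it holds for a single space, then a
   fortiori no constant C < 1 works for all normed spaces. It fails for the zero space, where every
   C works. *)
definition sharp ::
  "('k::real_normed_field \<Rightarrow> 'x::real_normed_vector \<Rightarrow> 'x) \<Rightarrow>
   (nat \<Rightarrow> (nat \<Rightarrow> real) \<Rightarrow> (nat \<Rightarrow> 'k) \<Rightarrow> (nat \<Rightarrow> 'x) \<Rightarrow> real) \<Rightarrow> bool" where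
  "sharp scale R \<longleftrightarrow>
     (\<forall>C>0. (\<forall>n\<ge>2. \<forall>p a x. (\<forall>i\<in>{1..n}. P p i \<noteq> 0) \<longrightarrow>
                norm (cebysev scale n p a x) \<le> C * R n p a x) \<longrightarrow> 1 \<le> C)"

end

theory Submission
  imports Defs "HOL-Analysis.Convex"
begin

text \<open>
  All three bounds come from one identity for the functional \<open>T\<^sub>n\<close> (\<open>cebysev\<close>),
  \<open>T\<^sub>n = P\<^sub>n \<Sum> P\<^sub>i E\<^sub>i \<Delta> x\<^sub>i\<close> with \<open>i\<close> running from \<open>1\<close> to \<open>n - 1\<close>, proved in
  \<open>cebysev_eq_sum_\<Delta>\<close>. Summation by parts (\<open>summation_by_parts\<close>) turns
  \<open>\<Sum> p\<^sub>i a\<^sub>i x\<^sub>i\<close> into \<open>A\<^sub>n x\<^sub>n - \<Sum> A\<^sub>i \<Delta> x\<^sub>i\<close> and \<open>\<Sum> p\<^sub>i x\<^sub>i\<close> into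
  \<open>P\<^sub>n x\<^sub>n - \<Sum> P\<^sub>i \<Delta> x\<^sub>i\<close>. In \<open>T\<^sub>n\<close> the boundary terms cancel, and the coefficient left in front of
  \<open>\<Delta> x\<^sub>i\<close> is \<open>A\<^sub>n P\<^sub>i - P\<^sub>n A\<^sub>i = P\<^sub>n P\<^sub>i E\<^sub>i\<close>. The triangle inequality then gives
  \<open>\<bar>P\<^sub>n\<bar> \<Sum> \<bar>P\<^sub>i\<bar> \<bar>E\<^sub>i\<bar> \<parallel>\<Delta> x\<^sub>i\<parallel>\<close> as a bound, and the three right-hand sides are the three
  cases of the Hoelder inequality for the weights \<open>\<bar>P\<^sub>i\<bar>\<close>: exponents \<open>(\<infinity>, 1)\<close>, \<open>(s, r)\<close> with
  \<open>1/r + 1/s = 1\<close>, and \<open>(1, \<infinity>)\<close>.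

  For sharpness, a two-point tuple suffices: the sum over \<open>i\<close> then has one term, so neither the
  triangle inequality nor the Hoelder inequality loses anything.
\<close>

text \<open>
  Each factor is normalised to have weighted norm one. Young's inequality, multiplied by the
  weight and summed, then bounds the normalised sum by \<open>1/r + 1/s = 1\<close>. If one of the norms
  vanishes, no normalisation is possible, but then every summand on the left is zero.
\<close>

lemma weighted_Hoelder_inequality_sum:
  fixes w f g :: "'i \<Rightarrow> real" and r s :: real
  assumes "finite I" "1 < r" "1 / r + 1 / s = 1"
    and w: "\<And>i. i \<in> I \<Longrightarrow> 0 \<le> w i"
    and f: "\<And>i. i \<in> I \<Longrightarrow> 0 \<le> f i"
    and g: "\<And>i. i \<in> I \<Longrightarrow> 0 \<le> g i"
  shows "(\<Sum>i\<in>I. w i * f i * g i)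
    \<le> (\<Sum>i\<in>I. w i * f i powr s) powr (1 / s) * (\<Sum>i\<in>I. w i * g i powr r) powr (1 / r)"
proof -
  define F where "F = (\<Sum>i\<in>I. w i * f i powr s)"
  define G where "G = (\<Sum>i\<in>I. w i * g i powr r)"
  have "0 < 1 / r" "1 / r < 1" using \<open>1 < r\<close> by simp_all
  then have "0 < 1 / s" "1 / s < 1" using assms(3) by linarith+
  then have "1 < s" by (simp add: divide_less_eq split: if_splits)
  have F_nonneg: "0 \<le> F" and G_nonneg: "0 \<le> G"
    unfolding F_def G_def using w by (auto intro!: sum_nonneg)
  show ?thesis
  proof (cases "F = 0 \<or> G = 0")
    case True
    then have "w i * f i * g i = 0" if "i \<in> I" for i
      using sum_nonneg_eq_0_iff[of I "\<lambda>i. w i * f i powr s"]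
        sum_nonneg_eq_0_iff[of I "\<lambda>i. w i * g i powr r"] w \<open>finite I\<close> that
      unfolding F_def G_def by auto
    then have "(\<Sum>i\<in>I. w i * f i * g i) = 0" by (intro sum.neutral ballI)
    then show ?thesis by simp
  next
    case False
    then have "0 < F" "0 < G" using F_nonneg G_nonneg by auto
    define u where "u = F powr (1 / s)"
    define v where "v = G powr (1 / r)"
    have uv: "0 < u" "0 < v" using \<open>0 < F\<close> \<open>0 < G\<close> by (auto simp: u_def v_def)
    have us: "u powr s = F" and vr: "v powr r = G"
      using \<open>0 < F\<close> \<open>0 < G\<close> \<open>1 < s\<close> \<open>1 < r\<close> by (simp_all add: u_def v_def powr_powr)
    have young: "w i * f i * g i / (u * v)
        \<le> (w i * g i powr r) / G / r + (w i * f i powr s) / F / s" if "i \<in> I" for i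
    proof -
      have "g i / v * (f i / u) \<le> (g i / v) powr r / r + (f i / u) powr s / s"
        using uv f g that assms(2,3) \<open>1 < s\<close> by (intro Youngs_inequality) auto
      also have "\<dots> = g i powr r / G / r + f i powr s / F / s"
        using uv f g that by (simp add: powr_divide us vr)
      finally have "w i * (g i / v * (f i / u)) \<le> w i * (g i powr r / G / r + f i powr s / F / s)"
        using w that by (intro mult_left_mono) auto
      then show ?thesis by (simp add: distrib_left mult_ac)
    qed
    have "(\<Sum>i\<in>I. w i * f i * g i) / (u * v) = (\<Sum>i\<in>I. w i * f i * g i / (u * v))"
      by (simp add: sum_divide_distrib)
    also have "\<dots> \<le> (\<Sum>i\<in>I. (w i * g i powr r) / G / r + (w i * f i powr s) / F / s)"
      by (intro sum_mono young)
    also have "\<dots> = G / G / r + F / F / s"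
      unfolding sum.distrib sum_divide_distrib[symmetric] by (simp add: F_def G_def)
    also have "\<dots> = 1" using \<open>0 < F\<close> \<open>0 < G\<close> assms(3) by simp
    finally show ?thesis
      using uv by (simp add: divide_le_eq u_def v_def F_def G_def)
  qed
qed

lemma (in vector_space) summation_by_parts:
  assumes "1 \<le> (n::nat)"
  shows "(\<Sum>i=1..n. scale (c i) (x i))
    = scale (\<Sum>k=1..n. c k) (x n) - (\<Sum>i=1..n-1. scale (\<Sum>k=1..i. c k) (x (i + 1) - x i))"
  using assms
proof (induction n rule: nat_induct_at_least)
  case base
  then show ?case by simp
next
  case (Suc n)
  then obtain m where "n = Suc m" by (cases n) auto
  with Suc.IH show ?case by (simp add: algebra_simps scale_left_distrib scale_right_diff_distrib)
qed

context normed_space_over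
begin

lemma cebysev_eq_sum_\<Delta>:
  assumes "1 \<le> n" and P: "\<forall>i\<in>{1..n}. P p i \<noteq> 0"
  shows "cebysev scale n p a x
    = (\<Sum>i=1..n-1. scale (of_real (P p n) * of_real (P p i) * E n p a i) (\<Delta> x i))"
proof -
  let ?P = "\<lambda>i. of_real (P p i) :: 'k" and ?A = "A p a"
  have P_sum: "(\<Sum>k=1..i. of_real (p k)) = ?P i" for i by (simp add: P_def)
  have ax: "(\<Sum>i=1..n. scale (of_real (p i) * a i) (x i))
      = scale (?A n) (x n) - (\<Sum>i=1..n-1. scale (?A i) (\<Delta> x i))"
    using summation_by_parts[OF \<open>1 \<le> n\<close>] by (simp add: A_def \<Delta>_def)
  have px: "(\<Sum>i=1..n. scale (of_real (p i)) (x i))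
      = scale (?P n) (x n) - (\<Sum>i=1..n-1. scale (?P i) (\<Delta> x i))"
    using summation_by_parts[OF \<open>1 \<le> n\<close>, of "\<lambda>i. of_real (p i)"] by (simp add: P_def \<Delta>_def)
  have coeff: "?P n * ?P i * E n p a i = ?A n * ?P i - ?P n * ?A i" if "i \<in> {1..n-1}" for i
  proof -
    have "?P n \<noteq> 0" "?P i \<noteq> 0" using P \<open>1 \<le> n\<close> that by auto
    then show ?thesis by (simp add: E_def field_simps)
  qed
  have "cebysev scale n p a x
      = scale (?A n) (\<Sum>i=1..n-1. scale (?P i) (\<Delta> x i))
        - scale (?P n) (\<Sum>i=1..n-1. scale (?A i) (\<Delta> x i))"
    unfolding cebysev_def ax px A_def[symmetric]
    by (simp add: scale_right_diff_distrib mult.commute)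
  also have "\<dots> = (\<Sum>i=1..n-1. scale (?A n * ?P i - ?P n * ?A i) (\<Delta> x i))"
    by (simp add: scale_sum_right scale_left_diff_distrib sum_subtractf)
  also have "\<dots> = (\<Sum>i=1..n-1. scale (?P n * ?P i * E n p a i) (\<Delta> x i))"
    by (rule sum.cong) (simp_all only: coeff)
  finally show ?thesis .
qed

lemma norm_cebysev_le:
  assumes "1 \<le> n" and "\<forall>i\<in>{1..n}. P p i \<noteq> 0"
  shows "norm (cebysev scale n p a x)
    \<le> \<bar>P p n\<bar> * (\<Sum>i=1..n-1. \<bar>P p i\<bar> * norm (E n p a i) * norm (\<Delta> x i))"
  unfolding cebysev_eq_sum_\<Delta>[OF assms] sum_distrib_left
  by (rule order_trans[OF norm_sum]) (simp add: norm_scale norm_mult mult.assoc)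

lemma norm_cebysev_le_max_sum:
  assumes "1 \<le> n" and "\<forall>i\<in>{1..n}. P p i \<noteq> 0"
  shows "norm (cebysev scale n p a x) \<le> bound_max_sum n p a x"
proof -
  let ?M = "Max ((\<lambda>i. norm (E n p a i)) ` {1..n-1})"
  have "(\<Sum>i=1..n-1. \<bar>P p i\<bar> * norm (E n p a i) * norm (\<Delta> x i))
      \<le> (\<Sum>i=1..n-1. \<bar>P p i\<bar> * ?M * norm (\<Delta> x i))"
    by (intro sum_mono mult_right_mono mult_left_mono Max_ge) auto
  also have "\<dots> = ?M * (\<Sum>i=1..n-1. \<bar>P p i\<bar> * norm (\<Delta> x i))"
    by (simp add: sum_distrib_left mult_ac)
  finally have "\<bar>P p n\<bar> * (\<Sum>i=1..n-1. \<bar>P p i\<bar> * norm (E n p a i) * norm (\<Delta> x i))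
      \<le> bound_max_sum n p a x"
    unfolding bound_max_sum_def mult.assoc[of "\<bar>P p n\<bar>"] by (rule mult_left_mono) simp
  with norm_cebysev_le[OF assms] show ?thesis by (rule order_trans)
qed

lemma norm_cebysev_le_Hoelder:
  assumes "1 \<le> n" and "\<forall>i\<in>{1..n}. P p i \<noteq> 0" and "1 < r" "1 / r + 1 / s = 1"
  shows "norm (cebysev scale n p a x) \<le> bound_Hoelder r s n p a x"
proof -
  have "\<bar>P p n\<bar> * (\<Sum>i=1..n-1. \<bar>P p i\<bar> * norm (E n p a i) * norm (\<Delta> x i))
      \<le> bound_Hoelder r s n p a x"
    unfolding bound_Hoelder_def mult.assoc[of "\<bar>P p n\<bar>"]
    by (intro mult_left_mono weighted_Hoelder_inequality_sum) (use assms in auto)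
  with norm_cebysev_le[OF assms(1,2)] show ?thesis by (rule order_trans)
qed

lemma norm_cebysev_le_sum_max:
  assumes "1 \<le> n" and "\<forall>i\<in>{1..n}. P p i \<noteq> 0"
  shows "norm (cebysev scale n p a x) \<le> bound_sum_max n p a x"
proof -
  let ?M = "Max ((\<lambda>i. norm (\<Delta> x i)) ` {1..n-1})"
  have "(\<Sum>i=1..n-1. \<bar>P p i\<bar> * norm (E n p a i) * norm (\<Delta> x i))
      \<le> (\<Sum>i=1..n-1. \<bar>P p i\<bar> * norm (E n p a i) * ?M)"
    by (intro sum_mono mult_left_mono Max_ge) auto
  also have "\<dots> = (\<Sum>i=1..n-1. \<bar>P p i\<bar> * norm (E n p a i)) * ?M"
    by (simp add: sum_distrib_right)
  finally have "\<bar>P p n\<bar> * (\<Sum>i=1..n-1. \<bar>P p i\<bar> * norm (E n p a i) * norm (\<Delta> x i))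
      \<le> bound_sum_max n p a x"
    unfolding bound_sum_max_def mult.assoc[of "\<bar>P p n\<bar>"] by (rule mult_left_mono) simp
  with norm_cebysev_le[OF assms] show ?thesis by (rule order_trans)
qed

lemma sharpI:
  assumes "2 \<le> n" "\<forall>i\<in>{1..n}. P p i \<noteq> 0"
    and "cebysev scale n p a x \<noteq> 0" "R n p a x = norm (cebysev scale n p a x)"
  shows "sharp scale R"
  unfolding sharp_def
proof (intro allI impI)
  fix C :: real
  assume "\<forall>n\<ge>2. \<forall>p a x. (\<forall>i\<in>{1..n}. P p i \<noteq> 0) \<longrightarrow> norm (cebysev scale n p a x) \<le> C * R n p a x"
  then have "norm (cebysev scale n p a x) \<le> C * norm (cebysev scale n p a x)"
    using assms by metis
  then show "1 \<le> C" using assms(3) by simp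
qed

text \<open>
  With two points each sum and each maximum has a single entry, so all bounds agree with \<open>\<parallel>T\<^sub>2\<parallel>\<close>,
  and it is enough that \<open>T\<^sub>2 \<noteq> 0\<close>. For \<open>p = (1, 1)\<close>, \<open>a = (0, 1)\<close>, \<open>x = (0, v)\<close> one has \<open>P\<^sub>1 = 1\<close>, \<open>P\<^sub>2 = 2\<close>,
  \<open>E\<^sub>1 = 1/2\<close> and \<open>\<Delta> x\<^sub>1 = v\<close>, so that \<open>T\<^sub>2 = v\<close> and every bound equals \<open>2 \<cdot> 1/2 \<cdot> \<parallel>v\<parallel>\<close>.
\<close>

lemma sharp_bounds:
  fixes v :: 'x
  assumes "v \<noteq> 0"
  shows "sharp scale bound_max_sum"
    and "1 < r \<Longrightarrow> 1 / r + 1 / s = 1 \<Longrightarrow> sharp scale (bound_Hoelder r s)"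
    and "sharp scale bound_sum_max"
proof -
  define p :: "nat \<Rightarrow> real" where "p = (\<lambda>_. 1)"
  define a :: "nat \<Rightarrow> 'k" where "a = (\<lambda>i. if i = 2 then 1 else 0)"
  define x :: "nat \<Rightarrow> 'x" where "x = (\<lambda>i. if i = 2 then v else 0)"
  have P: "P p 1 = 1" "P p 2 = 2" by (simp_all add: P_def p_def)
  have P_nonzero: "\<forall>i\<in>{1..2}. P p i \<noteq> 0" by (auto simp: P_def p_def)
  have "A p a 1 = 0" "A p a 2 = 1" by (simp_all add: A_def p_def a_def numeral_2_eq_2)
  then have E: "E 2 p a 1 = 1 / 2" by (simp add: E_def P)
  then have norm_E: "norm (E 2 p a 1) = 1 / 2" by (simp only: norm_divide norm_one norm_numeral)
  have \<Delta>: "\<Delta> x 1 = v" by (simp add: \<Delta>_def x_def)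
  have T: "cebysev scale 2 p a x = v"
  proof -
    have "{1..2 - 1} = {1::nat}" by auto
    then have "cebysev scale 2 p a x
        = scale (of_real (P p 2) * of_real (P p 1) * E 2 p a 1) (\<Delta> x 1)"
      using cebysev_eq_sum_\<Delta>[OF _ P_nonzero, of a x] by simp
    then show ?thesis unfolding P E \<Delta> by simp
  qed
  show "sharp scale bound_max_sum"
    by (rule sharpI[of 2 p a x])
      (use P_nonzero T P norm_E \<Delta> assms in \<open>simp_all add: bound_max_sum_def\<close>)
  show "sharp scale bound_sum_max"
    by (rule sharpI[of 2 p a x])
      (use P_nonzero T P norm_E \<Delta> assms in \<open>simp_all add: bound_sum_max_def\<close>)
  assume rs: "1 < r" "1 / r + 1 / s = 1"
  \<comment> \<open>With \<open>s = 0\<close> the convention \<open>1 / 0 = 0\<close> would force \<open>r = 1\<close>.\<close>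
  then have "s \<noteq> 0" by auto
  then show "sharp scale (bound_Hoelder r s)"
    using rs by (intro sharpI[of 2 p a x])
      (use P_nonzero T P norm_E \<Delta> assms in \<open>simp_all add: bound_Hoelder_def powr_powr\<close>)
qed

end

theorem theorem5:
  fixes scale :: "'k::real_normed_field \<Rightarrow> 'x::real_normed_vector \<Rightarrow> 'x"
  assumes "normed_space_over scale"
  shows
    "(\<forall>n\<ge>2. \<forall>(p :: nat \<Rightarrow> real) (a :: nat \<Rightarrow> 'k) (x :: nat \<Rightarrow> 'x).
        (\<forall>i\<in>{1..n}. P p i \<noteq> 0) \<longrightarrow>
          norm (cebysev scale n p a x) \<le> bound_max_sum n p a x \<and>
          (\<forall>r s. 1 < r \<and> 1 / r + 1 / s = 1 \<longrightarrow>
             norm (cebysev scale n p a x) \<le> bound_Hoelder r s n p a x) \<and>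
          norm (cebysev scale n p a x) \<le> bound_sum_max n p a x) \<and>
     ((\<exists>v::'x. v \<noteq> 0) \<longrightarrow>
        sharp scale bound_max_sum \<and>
        (\<forall>r s. 1 < r \<and> 1 / r + 1 / s = 1 \<longrightarrow> sharp scale (bound_Hoelder r s)) \<and>
        sharp scale bound_sum_max)"
proof -
  interpret normed_space_over scale by fact
  show ?thesis
  proof (intro conjI allI impI; (elim exE conjE)?)
    fix n :: nat and p :: "nat \<Rightarrow> real" and a :: "nat \<Rightarrow> 'k" and x :: "nat \<Rightarrow> 'x"
    assume "2 \<le> n" and P: "\<forall>i\<in>{1..n}. P p i \<noteq> 0"
    then have n: "1 \<le> n" by simp
    show "norm (cebysev scale n p a x) \<le> bound_max_sum n p a x"
      by (rule norm_cebysev_le_max_sum[OF n P])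
    show "norm (cebysev scale n p a x) \<le> bound_sum_max n p a x"
      by (rule norm_cebysev_le_sum_max[OF n P])
    show "norm (cebysev scale n p a x) \<le> bound_Hoelder r s n p a x"
      if "1 < r" "1 / r + 1 / s = 1" for r s
      by (rule norm_cebysev_le_Hoelder[OF n P that])
  qed (rule sharp_bounds; assumption)+
qed

end
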